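(* Let $\lambda>0$ and $\delta\in(0,1]$. Let $\Pi_{\mathrm{S}}=\{\pi_1,\dots,\pi_m\}$ be a finite set of policies, let $\pi_*^{\mathrm{S}}\in\operatorname{argmin}_{\pi\in\Pi_{\mathrm{S}}}R(\pi)$ and let $\hat\pi_n^{\mathrm{S}}\in\operatorname{argmin}_{\pi\in\Pi_{\mathrm{S}}}\hat{R}^\lambda_n(\pi)$. Then, with probability at least $1-\delta$, $$0\le R(\hat\pi_n^{\mathrm{S}})-R(\pi_*^{\mathrm{S}})\le\lambda\,\mathcal{S}_\lambda(\pi_*^{\mathrm{S}})+\frac{2\ln(2|\Pi_{\mathrm{S}}|/\delta)}{\lambda n}.$$
   Context: Setting (offline contextual bandit). $\mathcal{X}\subset\mathbb{R}^d$ is a compact context space, $\mathcal{A}=\{1,\dots,K\}$ a finite action set, $\nu$ a probability distribution on $\mathcal{X}$. A policy $\pi$ assigns to each $x\in\mathcal{X}$ a probability distribution $\pi(\cdot|x)$ on $\mathcal{A}$; $\pi_0$ is a fixed behavior policy. Given $(x,a)$, a cost $c\in[-1,0]$ is drawn from a distribution $p(\cdot|x,a)$, with mean $c(x,a)$. The logged data $\mathcal{D}_n=(x_i,a_i,c_i)_{i\in[n]}$ consists of $n$ i.i.d. tuples with $x_i\sim\nu$, $a_i\sim\pi_0(\cdot|x_i)$, $c_i\sim p(\cdot|x_i,a_i)$; probabilities are over $\mathcal{D}_n$. The risk of a policy is $R(\pi)=\mathbb{E}_{x\sim\nu,\,a\sim\pi(\cdot|x)}[c(x,a)]$. The policies $\pi_1,\dots,\pi_m$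 are fixed independently of the data. Coverage assumption on the optimal policy: for $\nu$-almost every $x$ and every $a$, $\pi_*^{\mathrm{S}}(a|x)>0$ implies $\pi_0(a|x)>0$. Notation. $w_\pi(x,a)=\pi(a|x)/\pi_0(a|x)$. The Logarithmic Smoothing estimator is $$\hat{R}^\lambda_n(\pi)=-\frac1n\sum_{i=1}^n\frac1\lambda\log\big(1-\lambda w_\pi(x_i,a_i)c_i\big),$$ and $$\mathcal{S}_\lambda(\pi)=\mathbb{E}\left[\frac{(w_\pi(x,a)c)^2}{1-\lambda w_\pi(x,a)c}\right],$$ where the expectation is over $x\sim\nu$, $a\sim\pi_0(\cdot|x)$, $c\sim p(\cdot|x,a)$. *)

theory Defs
  imports "HOL-Probability.Probability"
begin

text \<open>
  Contexts range over a compact set \<open>X\<close> of vectors with its Borel sigma-algebra, actions over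
  \<open>{1..K}\<close>, costs over \<open>[-1, 0]\<close>.  Policies and the conditional cost distribution are Markov
  kernels, i.e. measurable maps into the Giry monad of probability measures; their values outside
  \<open>X\<close> play no role.
\<close>

definition policies :: "(real ^ 'd) set \<Rightarrow> nat \<Rightarrow> (real ^ 'd \<Rightarrow> nat measure) set" where
  "policies X K = restrict_space borel X \<rightarrow>\<^sub>M prob_algebra (count_space {1..K})"

definition cost_kernels :: "(real ^ 'd) set \<Rightarrow> nat \<Rightarrow> (real ^ 'd \<Rightarrow> nat \<Rightarrow> real measure) set" where
  "cost_kernels X K = {p. case_prod p \<in> restrict_space borel X \<Otimes>\<^sub>M count_space {1..K}
                          \<rightarrow>\<^sub>M prob_algebra (restrict_space borel {-1..0})}"

definition mean_cost :: "(real ^ 'd \<Rightarrow> nat \<Rightarrow> real measure) \<Rightarrow> real ^ 'd \<Rightarrow> nat \<Rightarrow> real" where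
  "mean_cost p x a = (\<integral>c. c \<partial>p x a)"

definition risk ::
  "(real ^ 'd) measure \<Rightarrow> (real ^ 'd \<Rightarrow> nat \<Rightarrow> real measure) \<Rightarrow> (real ^ 'd \<Rightarrow> nat measure) \<Rightarrow> real"
  where "risk \<nu> p \<pi> = (\<integral>x. (\<integral>a. mean_cost p x a \<partial>\<pi> x) \<partial>\<nu>)"

text \<open>
  The joint law of one logged tuple \<open>(x, a, c)\<close>: draw \<open>x\<close> from \<open>\<nu>\<close>, then \<open>a\<close> from
  \<open>\<pi>0 x\<close>, then \<open>c\<close> from \<open>p x a\<close>.
\<close>

definition logged_law ::
  "(real ^ 'd) set \<Rightarrow> nat \<Rightarrow> (real ^ 'd) measure \<Rightarrow> (real ^ 'd \<Rightarrow> nat \<Rightarrow> real measure)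
    \<Rightarrow> (real ^ 'd \<Rightarrow> nat measure) \<Rightarrow> ((real ^ 'd) \<times> nat \<times> real) measure" where
  "logged_law X K \<nu> p \<pi>0 =
     \<nu> \<bind> (\<lambda>x. \<pi>0 x \<bind> (\<lambda>a. p x a \<bind> (\<lambda>c.
       return (restrict_space borel X \<Otimes>\<^sub>M count_space {1..K} \<Otimes>\<^sub>M restrict_space borel {-1..0})
         (x, a, c))))"

definition data_law ::
  "(real ^ 'd) set \<Rightarrow> nat \<Rightarrow> (real ^ 'd) measure \<Rightarrow> (real ^ 'd \<Rightarrow> nat \<Rightarrow> real measure)
    \<Rightarrow> (real ^ 'd \<Rightarrow> nat measure) \<Rightarrow> nat \<Rightarrow> (nat \<Rightarrow> (real ^ 'd) \<times> nat \<times> real) measure" where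
  "data_law X K \<nu> p \<pi>0 n = PiM {1..n} (\<lambda>_. logged_law X K \<nu> p \<pi>0)"

text \<open>
  Division by zero yields \<open>0\<close> where the behavior policy gives no mass to \<open>a\<close>; such pairs
  \<open>(x, a)\<close> have probability zero under the logging distribution.
\<close>

definition weight ::
  "(real ^ 'd \<Rightarrow> nat measure) \<Rightarrow> (real ^ 'd \<Rightarrow> nat measure) \<Rightarrow> real ^ 'd \<Rightarrow> nat \<Rightarrow> real" where
  "weight \<pi>0 \<pi> x a = measure (\<pi> x) {a} / measure (\<pi>0 x) {a}"

definition LS_estimator ::
  "real \<Rightarrow> (real ^ 'd \<Rightarrow> nat measure) \<Rightarrow> nat \<Rightarrow> (nat \<Rightarrow> (real ^ 'd) \<times> nat \<times> real)
    \<Rightarrow> (real ^ 'd \<Rightarrow> nat measure) \<Rightarrow> real" where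
  "LS_estimator lam \<pi>0 n D \<pi> =
     - (1 / real n) * (\<Sum>i=1..n. case D i of (x, a, c) \<Rightarrow>
         1 / lam * ln (1 - lam * weight \<pi>0 \<pi> x a * c))"

definition S_moment ::
  "(real ^ 'd) set \<Rightarrow> nat \<Rightarrow> (real ^ 'd) measure \<Rightarrow> (real ^ 'd \<Rightarrow> nat \<Rightarrow> real measure)
    \<Rightarrow> (real ^ 'd \<Rightarrow> nat measure) \<Rightarrow> real \<Rightarrow> (real ^ 'd \<Rightarrow> nat measure) \<Rightarrow> real" where
  "S_moment X K \<nu> p \<pi>0 lam \<pi> =
     (\<integral>z. (case z of (x, a, c) \<Rightarrow>
         (weight \<pi>0 \<pi> x a * c)\<^sup>2 / (1 - lam * weight \<pi>0 \<pi> x a * c)) \<partial>logged_law X K \<nu> p \<pi>0)"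

end

theory Submission
  imports Defs
begin

text \<open>
  Write \<open>L = - w c \<ge> 0\<close> for the importance-weighted loss of a tuple under a policy \<open>\<pi>\<close> with risk
  \<open>R\<close>.  The estimator is minus the average of \<open>ln (1 + \<lambda> L)\<close>, divided by \<open>\<lambda>\<close>, so its exponential moments
  are explicit: \<open>E (1 + \<lambda> L) \<le> 1 - \<lambda> R \<le> exp (- \<lambda> R)\<close> and, when the coverage assumption turns
  \<open>E L \<le> - R\<close> into an equality,
  \<open>E (1 / (1 + \<lambda> L)) = E (1 - \<lambda> L + \<lambda>\<^sup>2 L\<^sup>2 / (1 + \<lambda> L)) \<le> exp (\<lambda> R + \<lambda>\<^sup>2 S)\<close>.  Markov's
  inequality then gives one-sided deviation bounds at level \<open>\<delta> / (2 m)\<close>: an upper bound on the risk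
  of each of the \<open>m\<close> policies and an upper bound on the estimator of the optimal one.  Off these
  \<open>m + 1\<close> events the risk of the selected policy is compared with the optimum through the estimator.
\<close>

section \<open>Integration over a finite set and a Chernoff bound for i.i.d. samples\<close>

lemma nn_integral_finite_discrete:
  assumes "finite A" and sets: "sets M = Pow A"
  shows "(\<integral>\<^sup>+a. f a \<partial>M) = (\<Sum>a\<in>A. f a * emeasure M {a})"
proof -
  have space: "space M = A"
    using sets sets_eq_imp_space_eq[of M "count_space A"] by simp
  have meas: "g \<in> borel_measurable M" for g :: "_ \<Rightarrow> ennreal"
    using sets by (simp cong: measurable_cong_sets add: space sets measurable_def)
  have "(\<integral>\<^sup>+a. f a \<partial>M) = (\<integral>\<^sup>+x. (\<Sum>a\<in>A. f a * indicator {a} x) \<partial>M)"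
    using \<open>finite A\<close>
    by (intro nn_integral_cong) (simp add: space indicator_def of_bool_def if_distrib sum.delta cong: if_cong)
  also have "\<dots> = (\<Sum>a\<in>A. f a * emeasure M {a})"
    by (simp add: nn_integral_sum meas nn_integral_cmult_indicator sets)
  finally show ?thesis .
qed

lemma space_prob_algebraD:
  assumes "M \<in> space (prob_algebra N)"
  shows "prob_space M" "sets M = sets N" "space M = space N"
  using assms sets_eq_imp_space_eq[of M N] by (auto simp: space_prob_algebra)

text \<open>Chernoff's argument: the exponential of a sum is a product, and its expectation under
  the product measure is the n-th power of a single expectation. With the bound stated as a
  nonnegative integral, integrability of the exponential comes for free. The threshold is the one at
  which Markov's inequality yields exactly \<open>\<epsilon>\<close>.\<close>

lemma iid_exponential_Markov:
  fixes h :: "'a \<Rightarrow> real" and n :: nat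
  assumes M: "prob_space M" and h [measurable]: "h \<in> borel_measurable M"
    and bound: "(\<integral>\<^sup>+z. ennreal (exp (h z)) \<partial>M) \<le> ennreal (exp b)" and "\<epsilon> > 0"
  defines "P \<equiv> PiM {1..n} (\<lambda>_. M)"
  defines "B \<equiv> {D \<in> space P. real n * b + ln (1 / \<epsilon>) < (\<Sum>i=1..n. h (D i))}"
  shows "B \<in> sets P" "measure P B \<le> \<epsilon>"
proof -
  interpret M: prob_space M by fact
  interpret product_sigma_finite "\<lambda>_::nat. M" by standard
  interpret P: prob_space P
    unfolding P_def by (intro prob_space_PiM M)
  have hD [measurable]: "(\<lambda>D. h (D i)) \<in> borel_measurable P" if "i \<in> {1..n}" for i
    unfolding P_def using that by measurable
  then have sum_meas [measurable]: "(\<lambda>D. \<Sum>i=1..n. h (D i)) \<in> borel_measurable P"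
    by (intro borel_measurable_sum)
  show B: "B \<in> sets P"
    unfolding B_def by measurable
  define t where "t = real n * b + ln (1 / \<epsilon>)"
  \<comment> \<open>Markov's inequality is used in the form with threshold 1 and a constant factor,
    here \<open>exp (- t)\<close>, which avoids division in \<open>ennreal\<close>.\<close>
  have "emeasure P B \<le> emeasure P {D \<in> space P. 1 \<le> ennreal (exp (- t)) * ennreal (exp (\<Sum>i=1..n. h (D i)))}"
    by (rule emeasure_mono) (auto simp: B_def t_def simp flip: ennreal_mult exp_add)
  also have "\<dots> \<le> ennreal (exp (- t)) *
      (\<integral>\<^sup>+D. ennreal (exp (\<Sum>i=1..n. h (D i))) * indicator (space P) D \<partial>P)"
    by (rule nn_integral_Markov_inequality) auto
  also have "(\<integral>\<^sup>+D. ennreal (exp (\<Sum>i=1..n. h (D i))) * indicator (space P) D \<partial>P)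
      = (\<integral>\<^sup>+D. (\<Prod>i=1..n. ennreal (exp (h (D i)))) \<partial>P)"
    by (intro nn_integral_cong) (simp add: exp_sum prod_ennreal)
  also have "\<dots> = (\<integral>\<^sup>+z. ennreal (exp (h z)) \<partial>M) ^ n"
    unfolding P_def by (subst product_nn_integral_prod) auto
  also have "\<dots> \<le> ennreal (exp b) ^ n"
    by (intro power_mono bound) simp
  also have "\<dots> = ennreal (exp (real n * b))"
    by (simp add: ennreal_power exp_of_nat_mult)
  also have "ennreal (exp (- t)) * \<dots> = ennreal \<epsilon>"
    using \<open>\<epsilon> > 0\<close> by (simp add: t_def ln_div flip: ennreal_mult exp_add)
  finally show "measure P B \<le> \<epsilon>"
    using \<open>\<epsilon> > 0\<close> by (simp add: P.emeasure_eq_measure mult_left_mono)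
qed

section \<open>Measurability of the logging mechanism and iterated integrals under its law\<close>

locale logged_bandit =
  fixes X :: "(real ^ 'd) set" and K :: nat
    and \<nu> :: "(real ^ 'd) measure"
    and p :: "real ^ 'd \<Rightarrow> nat \<Rightarrow> real measure"
    and \<pi>0 :: "real ^ 'd \<Rightarrow> nat measure"
  assumes \<nu>: "\<nu> \<in> space (prob_algebra (restrict_space borel X))"
    and p: "p \<in> cost_kernels X K"
    and \<pi>0: "\<pi>0 \<in> policies X K"
begin

abbreviation "contexts \<equiv> restrict_space (borel :: (real ^ 'd) measure) X"
abbreviation "actions \<equiv> count_space {1..K}"
abbreviation "costs \<equiv> restrict_space (borel :: real measure) {-1..0}"
abbreviation "tuples \<equiv> contexts \<Otimes>\<^sub>M actions \<Otimes>\<^sub>M costs"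
abbreviation "law \<equiv> logged_law X K \<nu> p \<pi>0"

sublocale context_law: prob_space \<nu>
  using \<nu> by (rule space_prob_algebraD)

lemma context_law_sets [measurable_cong]: "sets \<nu> = sets contexts"
  and context_law_space [simp]: "space \<nu> = X"
  using space_prob_algebraD[OF \<nu>] by (auto simp: space_restrict_space)

lemma cost_kernel_measurable [measurable]:
  "case_prod p \<in> contexts \<Otimes>\<^sub>M actions \<rightarrow>\<^sub>M prob_algebra costs"
  using p by (simp add: cost_kernels_def)

lemma policy_measurable:
  "\<pi> \<in> policies X K \<Longrightarrow> \<pi> \<in> contexts \<rightarrow>\<^sub>M prob_algebra actions"
  by (simp add: policies_def)

lemma policy_at:
  assumes "\<pi> \<in> policies X K" "x \<in> X"
  shows "prob_space (\<pi> x)" "sets (\<pi> x) = Pow {1..K}" "space (\<pi> x) = {1..K}"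
  using space_prob_algebraD[OF measurable_space[OF policy_measurable[OF assms(1)]], of x] assms(2)
  by (auto simp: space_restrict_space)

lemma cost_at:
  assumes "x \<in> X" "a \<in> {1..K}"
  shows "prob_space (p x a)" "sets (p x a) = sets costs" "space (p x a) = {-1..0}"
  using space_prob_algebraD[OF measurable_space[OF cost_kernel_measurable], of "(x, a)"] assms
  by (auto simp: space_restrict_space space_pair_measure)

text \<open>The nested binds of the logged law are shown to be kernels from the inside out: first
  the cost given context and action, jointly in both, then the action given the context.\<close>

lemma tuple_kernel_measurable:
  "(\<lambda>(x, a). p x a \<bind> (\<lambda>c. return tuples (x, a, c)))
     \<in> contexts \<Otimes>\<^sub>M actions \<rightarrow>\<^sub>M prob_algebra tuples"
proof -
  have "(\<lambda>z. case_prod p z \<bind> (\<lambda>c. return tuples (fst z, snd z, c)))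
     \<in> contexts \<Otimes>\<^sub>M actions \<rightarrow>\<^sub>M prob_algebra tuples"
    by (rule measurable_bind_prob_space2[OF cost_kernel_measurable]) measurable
  then show ?thesis
    by (simp add: case_prod_beta)
qed

lemma context_kernel_measurable:
  "(\<lambda>x. \<pi>0 x \<bind> (\<lambda>a. p x a \<bind> (\<lambda>c. return tuples (x, a, c))))
     \<in> contexts \<rightarrow>\<^sub>M prob_algebra tuples"
  by (rule measurable_bind_prob_space2[OF policy_measurable[OF \<pi>0] tuple_kernel_measurable])

lemma law_in_prob_algebra: "law \<in> space (prob_algebra tuples)"
proof -
  \<comment> \<open>Viewing \<open>\<nu>\<close> as a constant kernel on a one-point space lets the
    composition rule for kernels produce a single probability measure.\<close>
  have "(\<lambda>_::unit. \<nu>) \<in> count_space UNIV \<rightarrow>\<^sub>M prob_algebra contexts"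
    using \<nu> by simp
  from measurable_space[OF measurable_bind_prob_space[OF this context_kernel_measurable], of "()"]
  show ?thesis
    by (simp add: logged_law_def)
qed

sublocale law: prob_space law
  using law_in_prob_algebra by (rule space_prob_algebraD)

lemma law_sets [measurable_cong]: "sets law = sets tuples"
  and law_space: "space law = space tuples"
  using space_prob_algebraD[OF law_in_prob_algebra] by auto

text \<open>Each bind integrates by one more iterated integral, and the innermost
  \<open>return\<close> evaluates the integrand. This is the link from expectations over logged
  tuples to \<open>\<nu>\<close>, \<open>\<pi>0\<close> and \<open>p\<close>.\<close>

lemma nn_integral_law:
  assumes f [measurable]: "f \<in> borel_measurable tuples"
  shows "(\<integral>\<^sup>+z. f z \<partial>law) = (\<integral>\<^sup>+x. \<integral>\<^sup>+a. \<integral>\<^sup>+c. f (x, a, c) \<partial>p x a \<partial>\<pi>0 x \<partial>\<nu>)"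
proof -
  have k: "(\<lambda>x. \<pi>0 x \<bind> (\<lambda>a. p x a \<bind> (\<lambda>c. return tuples (x, a, c))))
     \<in> \<nu> \<rightarrow>\<^sub>M subprob_algebra tuples"
    using measurable_prob_algebraD[OF context_kernel_measurable]
    by (simp cong: measurable_cong_sets add: context_law_sets)
  have "(\<integral>\<^sup>+z. f z \<partial>(\<pi>0 x \<bind> (\<lambda>a. p x a \<bind> (\<lambda>c. return tuples (x, a, c)))))
      = (\<integral>\<^sup>+a. \<integral>\<^sup>+c. f (x, a, c) \<partial>p x a \<partial>\<pi>0 x)" if x: "x \<in> X" for x
  proof -
    \<comment> \<open>For a fixed context the kernel in the action alone is a section of the jointly
      measurable one.\<close>
    have pair: "Pair x \<in> actions \<rightarrow>\<^sub>M contexts \<Otimes>\<^sub>M actions"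
      using x by (intro measurable_Pair1') (simp add: space_restrict_space)
    have kx: "(\<lambda>a. p x a \<bind> (\<lambda>c. return tuples (x, a, c))) \<in> \<pi>0 x \<rightarrow>\<^sub>M subprob_algebra tuples"
      using measurable_compose[OF pair measurable_prob_algebraD[OF tuple_kernel_measurable]]
      unfolding prod.case
      by (subst measurable_cong_sets[where M'=actions and N'="subprob_algebra tuples"])
         (simp_all only: policy_at[OF \<pi>0 x] sets_count_space)
    have inner: "(\<integral>\<^sup>+z. f z \<partial>(p x a \<bind> (\<lambda>c. return tuples (x, a, c)))) = (\<integral>\<^sup>+c. f (x, a, c) \<partial>p x a)"
      if a: "a \<in> {1..K}" for a
    proof -
      have [measurable_cong]: "sets (p x a) = sets costs"
        by (rule cost_at[OF x a])
      have xa: "x \<in> space contexts" "a \<in> space actions"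
        using x a by (auto simp: space_restrict_space)
      then have "(\<lambda>c. (x, a, c)) \<in> p x a \<rightarrow>\<^sub>M tuples"
        by measurable
      then have "(\<lambda>c. return tuples (x, a, c)) \<in> p x a \<rightarrow>\<^sub>M subprob_algebra tuples"
        by (rule measurable_compose) (rule return_measurable)
      then have "(\<integral>\<^sup>+z. f z \<partial>(p x a \<bind> (\<lambda>c. return tuples (x, a, c))))
          = (\<integral>\<^sup>+c. \<integral>\<^sup>+z. f z \<partial>return tuples (x, a, c) \<partial>p x a)"
        by (rule nn_integral_bind[OF f])
      also have "\<dots> = (\<integral>\<^sup>+c. f (x, a, c) \<partial>p x a)"
        using cost_at[OF x a] xa
        by (intro nn_integral_cong nn_integral_return f)
          (auto simp: space_pair_measure space_restrict_space)
      finally show ?thesis .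
    qed
    show ?thesis
      by (subst nn_integral_bind[OF f kx], rule nn_integral_cong)
         (simp only: policy_at[OF \<pi>0 x] inner)
  qed
  then show ?thesis
    unfolding logged_law_def
    by (subst nn_integral_bind[OF f k]) (auto intro!: nn_integral_cong)
qed

section \<open>Mean costs and risk as nonnegative integrals\<close>

lemma mean_cost_bounds:
  assumes "x \<in> X" "a \<in> {1..K}"
  shows "(\<integral>\<^sup>+c. ennreal (- c) \<partial>p x a) = ennreal (- mean_cost p x a)"
    and "mean_cost p x a \<in> {-1..0}"
proof -
  interpret prob_space "p x a" by (rule cost_at[OF assms])
  have [measurable_cong]: "sets (p x a) = sets costs" by (rule cost_at[OF assms])
  have [measurable]: "(\<lambda>c. c) \<in> borel_measurable (p x a)"
    by (simp cong: measurable_cong_sets add: cost_at(2)[OF assms] measurable_restrict_space1)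
  have ran: "c \<in> {-1..0}" if "c \<in> space (p x a)" for c
    using that cost_at(3)[OF assms] by simp
  have int: "integrable (p x a) (\<lambda>c. c)"
    using ran by (intro integrable_const_bound[where B=1] AE_I2) auto
  show "(\<integral>\<^sup>+c. ennreal (- c) \<partial>p x a) = ennreal (- mean_cost p x a)"
    unfolding mean_cost_def
    using ran int by (subst nn_integral_eq_integral) auto
  have "(\<integral>c. c \<partial>p x a) \<ge> -1"
    by (rule integral_ge_const[OF int]) (use ran in auto)
  moreover have "(\<integral>c. c \<partial>p x a) \<le> 0"
    by (rule integral_le_const[OF int]) (use ran in auto)
  ultimately show "mean_cost p x a \<in> {-1..0}"
    by (simp add: mean_cost_def)
qed

lemma mean_cost_measurable:
  "case_prod (mean_cost p) \<in> borel_measurable (contexts \<Otimes>\<^sub>M actions)"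
proof -
  have "(\<lambda>M. \<integral>c. c \<partial>M) \<in> borel_measurable (subprob_algebra costs)"
    by (intro integral_measurable_subprob_algebra measurable_restrict_space1) simp
  from measurable_compose[OF measurable_prob_algebraD[OF cost_kernel_measurable] this]
  have "(\<lambda>z. \<integral>c. c \<partial>case_prod p z) \<in> borel_measurable (contexts \<Otimes>\<^sub>M actions)" .
  also have "(\<lambda>z. \<integral>c. c \<partial>case_prod p z) = case_prod (mean_cost p)"
    by (auto simp: fun_eq_iff mean_cost_def)
  finally show ?thesis .
qed

text \<open>The risk is a nested Bochner integral. Since mean costs lie in [-1, 0], each layer is
  integrable and its negation agrees with a nonnegative integral, which is the form that can be
  compared with the law of a tuple.\<close>

lemma nn_integral_risk:
  assumes \<pi>: "\<pi> \<in> policies X K"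
  shows "(\<integral>\<^sup>+x. \<integral>\<^sup>+a. ennreal (- mean_cost p x a) \<partial>\<pi> x \<partial>\<nu>) = ennreal (- risk \<nu> p \<pi>)"
    and "risk \<nu> p \<pi> \<le> 0"
proof -
  define r where "r x = (\<integral>a. mean_cost p x a \<partial>\<pi> x)" for x
  have r: "(\<integral>\<^sup>+a. ennreal (- mean_cost p x a) \<partial>\<pi> x) = ennreal (- r x)" "r x \<in> {-1..0}"
    if x: "x \<in> X" for x
  proof -
    interpret prob_space "\<pi> x" by (rule policy_at[OF \<pi> x])
    have ran: "mean_cost p x a \<in> {-1..0}" if "a \<in> space (\<pi> x)" for a
      using that policy_at[OF \<pi> x] mean_cost_bounds(2)[OF x] by simp
    have "mean_cost p x \<in> borel_measurable (\<pi> x)"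
      by (simp cong: measurable_cong_sets add: policy_at[OF \<pi> x] flip: sets_count_space)
    then have int: "integrable (\<pi> x) (mean_cost p x)"
      using ran by (intro integrable_const_bound[where B=1] AE_I2) auto
    show "(\<integral>\<^sup>+a. ennreal (- mean_cost p x a) \<partial>\<pi> x) = ennreal (- r x)"
      unfolding r_def using ran int by (subst nn_integral_eq_integral) auto
    have "r x \<ge> -1" unfolding r_def
      by (rule integral_ge_const[OF int]) (use ran in auto)
    moreover have "r x \<le> 0" unfolding r_def
      by (rule integral_le_const[OF int]) (use ran in auto)
    ultimately show "r x \<in> {-1..0}" by simp
  qed
  have "r \<in> borel_measurable \<nu>"
  proof -
    \<comment> \<open>Measurability in the context is obtained for the nonnegative integral over the
      kernel and carried back to \<open>r\<close>, which equals its negated real value on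
      \<open>X\<close>.\<close>
    have "(\<lambda>x. \<integral>\<^sup>+a. ennreal (- mean_cost p x a) \<partial>\<pi> x) \<in> borel_measurable contexts"
      using mean_cost_measurable
      by (intro nn_integral_measurable_subprob_algebra2[OF _ measurable_prob_algebraD[OF policy_measurable[OF \<pi>]]])
         (simp add: case_prod_beta)
    then have "(\<lambda>x. - enn2real (\<integral>\<^sup>+a. ennreal (- mean_cost p x a) \<partial>\<pi> x)) \<in> borel_measurable contexts"
      by measurable
    also have "?this \<longleftrightarrow> r \<in> borel_measurable contexts"
      using r by (intro measurable_cong) (auto simp: space_restrict_space)
    finally show ?thesis
      by (simp cong: measurable_cong_sets add: context_law_sets)
  qed
  then have int: "integrable \<nu> r"
    using r by (intro context_law.integrable_const_bound[where B=1] AE_I2) auto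
  have "(\<integral>\<^sup>+x. \<integral>\<^sup>+a. ennreal (- mean_cost p x a) \<partial>\<pi> x \<partial>\<nu>) = (\<integral>\<^sup>+x. ennreal (- r x) \<partial>\<nu>)"
    using r by (intro nn_integral_cong) auto
  also have "\<dots> = ennreal (- risk \<nu> p \<pi>)"
    unfolding risk_def r_def[symmetric]
    using r int by (subst nn_integral_eq_integral) auto
  finally show "(\<integral>\<^sup>+x. \<integral>\<^sup>+a. ennreal (- mean_cost p x a) \<partial>\<pi> x \<partial>\<nu>) = ennreal (- risk \<nu> p \<pi>)" .
  show "risk \<nu> p \<pi> \<le> 0"
    unfolding risk_def r_def[symmetric]
    by (rule context_law.integral_le_const[OF int]) (use r in auto)
qed

section \<open>The importance-weighted loss and its expectation\<close>

definition loss :: "(real ^ 'd \<Rightarrow> nat measure) \<Rightarrow> (real ^ 'd) \<times> nat \<times> real \<Rightarrow> real" where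
  "loss \<pi> = (\<lambda>(x, a, c). - (weight \<pi>0 \<pi> x a * c))"

lemma weight_nonneg: "0 \<le> weight \<pi>0 \<pi> x a"
  by (simp add: weight_def)

lemma loss_nonneg: "z \<in> space tuples \<Longrightarrow> 0 \<le> loss \<pi> z"
  by (auto simp: loss_def space_pair_measure space_restrict_space weight_nonneg mult_nonneg_nonpos)

lemma policy_mass_measurable:
  assumes "\<pi> \<in> policies X K" "a \<in> {1..K}"
  shows "(\<lambda>x. measure (\<pi> x) {a}) \<in> borel_measurable contexts"
  using measurable_compose[OF measurable_prob_algebraD[OF policy_measurable[OF assms(1)]]
      measurable_measure_subprob_algebra, of "{a}"] assms(2) by simp

lemma loss_measurable:
  assumes \<pi>: "\<pi> \<in> policies X K"
  shows "loss \<pi> \<in> borel_measurable tuples"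
proof -
  have "(\<lambda>z. weight \<pi>0 \<pi> (fst z) (fst (snd z))) \<in> borel_measurable tuples"
  \<comment> \<open>The action at which the weight is taken varies with the tuple. As there are
    finitely many actions, it suffices to fix one, and then the weight is a quotient of two
    measurable functions of the context.\<close>
  proof (rule measurable_compose_countable'[where I="{1..K}"])
    fix a assume a: "a \<in> {1..K}"
    have "(\<lambda>x. weight \<pi>0 \<pi> x a) \<in> borel_measurable contexts"
      unfolding weight_def
      by (intro borel_measurable_divide policy_mass_measurable \<pi> \<pi>0 a)
    then show "(\<lambda>z. weight \<pi>0 \<pi> (fst z) a) \<in> borel_measurable tuples"
      by measurable
  qed (rule measurable_compose[OF measurable_snd measurable_fst], rule countable_finite, simp)
  moreover have "(\<lambda>z. snd (snd z)) \<in> borel_measurable tuples"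
  proof -
    have "(\<lambda>c. c) \<in> borel_measurable costs"
      by (simp add: measurable_restrict_space1)
    then show ?thesis by measurable
  qed
  ultimately show ?thesis
    unfolding loss_def case_prod_beta by (intro borel_measurable_uminus borel_measurable_times)
qed

text \<open>The product of weight and behavior mass is left uncancelled, so that it can be compared
  action by action with the target mass in \<open>nn_integral_risk_sum\<close>, with or without
  coverage.\<close>

lemma nn_integral_loss:
  assumes \<pi>: "\<pi> \<in> policies X K"
  shows "(\<integral>\<^sup>+z. ennreal (loss \<pi> z) \<partial>law)
    = (\<integral>\<^sup>+x. (\<Sum>a\<in>{1..K}. ennreal (- mean_cost p x a) *
        ennreal (weight \<pi>0 \<pi> x a * measure (\<pi>0 x) {a})) \<partial>\<nu>)"
proof -
  have "(\<integral>\<^sup>+z. ennreal (loss \<pi> z) \<partial>law)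
      = (\<integral>\<^sup>+x. \<integral>\<^sup>+a. \<integral>\<^sup>+c. ennreal (loss \<pi> (x, a, c)) \<partial>p x a \<partial>\<pi>0 x \<partial>\<nu>)"
    using loss_measurable[OF \<pi>] by (intro nn_integral_law) measurable
  also have "\<dots> = (\<integral>\<^sup>+x. (\<Sum>a\<in>{1..K}. ennreal (- mean_cost p x a) *
        ennreal (weight \<pi>0 \<pi> x a * measure (\<pi>0 x) {a})) \<partial>\<nu>)"
  proof (rule nn_integral_cong)
    fix x assume "x \<in> space \<nu>"
    then have x: "x \<in> X" by simp
    interpret prob_space "\<pi>0 x" by (rule policy_at[OF \<pi>0 x])
    have c: "(\<integral>\<^sup>+c. ennreal (loss \<pi> (x, a, c)) \<partial>p x a)
        = ennreal (weight \<pi>0 \<pi> x a) * ennreal (- mean_cost p x a)" if a: "a \<in> {1..K}" for a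
    proof -
      have [measurable]: "(\<lambda>c. c) \<in> borel_measurable (p x a)"
        by (simp cong: measurable_cong_sets add: cost_at(2)[OF x a] measurable_restrict_space1)
      have "(\<integral>\<^sup>+c. ennreal (loss \<pi> (x, a, c)) \<partial>p x a)
          = (\<integral>\<^sup>+c. ennreal (weight \<pi>0 \<pi> x a) * ennreal (- c) \<partial>p x a)"
        by (intro nn_integral_cong) (simp add: loss_def weight_nonneg flip: ennreal_mult')
      also have "\<dots> = ennreal (weight \<pi>0 \<pi> x a) * ennreal (- mean_cost p x a)"
        by (simp add: nn_integral_cmult mean_cost_bounds[OF x a])
      finally show ?thesis .
    qed
    show "(\<integral>\<^sup>+a. \<integral>\<^sup>+c. ennreal (loss \<pi> (x, a, c)) \<partial>p x a \<partial>\<pi>0 x)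
       = (\<Sum>a\<in>{1..K}. ennreal (- mean_cost p x a) *
           ennreal (weight \<pi>0 \<pi> x a * measure (\<pi>0 x) {a}))"
      by (subst nn_integral_finite_discrete[OF _ policy_at(2)[OF \<pi>0 x]], simp, rule sum.cong)
         (simp_all add: c emeasure_eq_measure ennreal_mult' weight_nonneg mult_ac)
  qed
  finally show ?thesis .
qed

lemma nn_integral_risk_sum:
  assumes \<pi>: "\<pi> \<in> policies X K"
  shows "ennreal (- risk \<nu> p \<pi>)
    = (\<integral>\<^sup>+x. (\<Sum>a\<in>{1..K}. ennreal (- mean_cost p x a) * ennreal (measure (\<pi> x) {a})) \<partial>\<nu>)"
proof -
  have "(\<integral>\<^sup>+a. ennreal (- mean_cost p x a) \<partial>\<pi> x)
      = (\<Sum>a\<in>{1..K}. ennreal (- mean_cost p x a) * ennreal (measure (\<pi> x) {a}))"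
    if x: "x \<in> X" for x
  proof -
    interpret prob_space "\<pi> x" by (rule policy_at[OF \<pi> x])
    show ?thesis
      by (subst nn_integral_finite_discrete[OF _ policy_at(2)[OF \<pi> x]])
         (simp_all add: emeasure_eq_measure)
  qed
  then show ?thesis
    unfolding nn_integral_risk(1)[OF \<pi>, symmetric] by (intro nn_integral_cong) auto
qed

text \<open>
  Strict inequality occurs when \<open>\<pi>\<close> charges actions that \<open>\<pi>0\<close> never plays: their weight is \<open>0\<close>.
\<close>

lemma nn_integral_loss_le:
  assumes \<pi>: "\<pi> \<in> policies X K"
  shows "(\<integral>\<^sup>+z. ennreal (loss \<pi> z) \<partial>law) \<le> ennreal (- risk \<nu> p \<pi>)"
  unfolding nn_integral_loss[OF \<pi>] nn_integral_risk_sum[OF \<pi>]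
  by (intro nn_integral_mono sum_mono mult_left_mono ennreal_leI)
     (auto simp: weight_def)

text \<open>Where \<open>\<pi>0\<close> has positive mass the weight cancels it. Where its mass is
  0, coverage forces the mass of \<open>\<pi>\<close> to be 0 as well, so both terms vanish.\<close>

lemma nn_integral_loss_eq:
  assumes \<pi>: "\<pi> \<in> policies X K"
    and "AE x in \<nu>. \<forall>a\<in>{1..K}. measure (\<pi> x) {a} > 0 \<longrightarrow> measure (\<pi>0 x) {a} > 0"
  shows "(\<integral>\<^sup>+z. ennreal (loss \<pi> z) \<partial>law) = ennreal (- risk \<nu> p \<pi>)"
  unfolding nn_integral_loss[OF \<pi>] nn_integral_risk_sum[OF \<pi>]
proof (rule nn_integral_cong_AE, use assms(2) in eventually_elim, rule sum.cong)
  fix x a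
  assume *: "\<forall>a\<in>{1..K}. measure (\<pi> x) {a} > 0 \<longrightarrow> measure (\<pi>0 x) {a} > 0" and a: "a \<in> {1..K}"
  have "weight \<pi>0 \<pi> x a * measure (\<pi>0 x) {a} = measure (\<pi> x) {a}"
    using *[rule_format, OF a] zero_less_measure_iff[of "\<pi> x" "{a}"] by (auto simp: weight_def)
  then show "ennreal (- mean_cost p x a) * ennreal (weight \<pi>0 \<pi> x a * measure (\<pi>0 x) {a})
      = ennreal (- mean_cost p x a) * ennreal (measure (\<pi> x) {a})"
    by simp
qed simp

text \<open>The importance weights may be unbounded; integrability comes from the finite bound by
  the negated risk.\<close>

lemma integrable_loss: "\<pi> \<in> policies X K \<Longrightarrow> integrable law (loss \<pi>)"
  using nn_integral_loss_le[of \<pi>] loss_measurable[of \<pi>]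
  by (intro integrableI_nonneg AE_I2)
     (auto simp: loss_nonneg law_space less_top[symmetric] top_unique cong: measurable_cong_sets)

lemma integral_loss_le:
  assumes "\<pi> \<in> policies X K"
  shows "(\<integral>z. loss \<pi> z \<partial>law) \<le> - risk \<nu> p \<pi>"
  using nn_integral_loss_le[OF assms] nn_integral_risk(2)[OF assms]
  by (subst (asm) nn_integral_eq_integral[OF integrable_loss[OF assms]])
     (auto simp: loss_nonneg law_space)

lemma integral_loss_eq:
  assumes "\<pi> \<in> policies X K"
    and "AE x in \<nu>. \<forall>a\<in>{1..K}. measure (\<pi> x) {a} > 0 \<longrightarrow> measure (\<pi>0 x) {a} > 0"
  shows "(\<integral>z. loss \<pi> z \<partial>law) = - risk \<nu> p \<pi>"
proof -
  \<comment> \<open>\<open>ennreal\<close> sends all negative reals to 0, so an equality of images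
    can be pulled back only between nonnegative numbers.\<close>
  have "0 \<le> (\<integral>z. loss \<pi> z \<partial>law)"
    by (intro integral_nonneg_AE AE_I2) (simp add: loss_nonneg law_space)
  moreover have "ennreal (\<integral>z. loss \<pi> z \<partial>law) = ennreal (- risk \<nu> p \<pi>)"
    unfolding nn_integral_loss_eq[OF assms, symmetric]
    by (intro nn_integral_eq_integral[OF integrable_loss[OF assms(1)], symmetric] AE_I2)
       (simp add: loss_nonneg law_space)
  ultimately show ?thesis
    using nn_integral_risk(2)[OF assms(1)] by (simp add: ennreal_inj)
qed

section \<open>Exponential moments of the logarithmically smoothed loss\<close>

abbreviation "risk_of \<equiv> risk \<nu> p"

lemma LS_estimator_eq:
  "LS_estimator lam \<pi>0 n D \<pi> = - (\<Sum>i=1..n. ln (1 + lam * loss \<pi> (D i))) / (lam * real n)"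
  by (simp add: LS_estimator_def loss_def case_prod_beta sum_distrib_left[symmetric] algebra_simps
      flip: sum_divide_distrib)

lemma S_moment_eq:
  "S_moment X K \<nu> p \<pi>0 lam \<pi> = (\<integral>z. (loss \<pi> z)\<^sup>2 / (1 + lam * loss \<pi> z) \<partial>law)"
  by (simp add: S_moment_def loss_def case_prod_beta mult.assoc)

lemma exp_ln_loss_le:
  assumes \<pi>: "\<pi> \<in> policies X K" and "lam > 0"
  shows "(\<integral>\<^sup>+z. ennreal (exp (ln (1 + lam * loss \<pi> z))) \<partial>law) \<le> ennreal (exp (- lam * risk_of \<pi>))"
proof -
  have int: "integrable law (\<lambda>z. 1 + lam * loss \<pi> z)"
    using integrable_loss[OF \<pi>] by simp
  have pos: "0 \<le> lam * loss \<pi> z" if "z \<in> space law" for z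
    using that \<open>lam > 0\<close> loss_nonneg by (simp add: law_space)
  have "(\<integral>\<^sup>+z. ennreal (exp (ln (1 + lam * loss \<pi> z))) \<partial>law) = (\<integral>\<^sup>+z. ennreal (1 + lam * loss \<pi> z) \<partial>law)"
    using pos by (intro nn_integral_cong) (simp add: add_pos_nonneg)
  also have "\<dots> = ennreal (\<integral>z. 1 + lam * loss \<pi> z \<partial>law)"
    using pos by (intro nn_integral_eq_integral[OF int] AE_I2) (simp add: add_nonneg_nonneg)
  also have "\<dots> = ennreal (1 + lam * (\<integral>z. loss \<pi> z \<partial>law))"
    using integrable_loss[OF \<pi>] by (simp add: law.prob_space)
  also have "\<dots> \<le> ennreal (exp (- lam * risk_of \<pi>))"
  proof (rule ennreal_leI)
    have "lam * (\<integral>z. loss \<pi> z \<partial>law) \<le> lam * (- risk_of \<pi>)"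
      using integral_loss_le[OF \<pi>] \<open>lam > 0\<close> by (intro mult_left_mono) auto
    then show "1 + lam * (\<integral>z. loss \<pi> z \<partial>law) \<le> exp (- lam * risk_of \<pi>)"
      using exp_ge_add_one_self[of "- lam * risk_of \<pi>"] by simp
  qed
  finally show ?thesis .
qed

text \<open>Here the expected loss appears with a negative sign, so it has to be bounded from below;
  this is where coverage enters.\<close>

lemma exp_neg_ln_loss_le:
  assumes \<pi>: "\<pi> \<in> policies X K" and "lam > 0"
    and cover: "AE x in \<nu>. \<forall>a\<in>{1..K}. measure (\<pi> x) {a} > 0 \<longrightarrow> measure (\<pi>0 x) {a} > 0"
  shows "(\<integral>\<^sup>+z. ennreal (exp (- ln (1 + lam * loss \<pi> z))) \<partial>law)
    \<le> ennreal (exp (lam * risk_of \<pi> + lam\<^sup>2 * S_moment X K \<nu> p \<pi>0 lam \<pi>))"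
proof -
  let ?s = "\<lambda>z. (loss \<pi> z)\<^sup>2 / (1 + lam * loss \<pi> z)"
  have pos: "0 \<le> lam * loss \<pi> z" "0 \<le> loss \<pi> z" if "z \<in> space law" for z
    using that \<open>lam > 0\<close> loss_nonneg by (simp_all add: law_space)
  have [measurable]: "loss \<pi> \<in> borel_measurable law"
    using integrable_loss[OF \<pi>] by auto
  \<comment> \<open>Since \<open>lam * L / (1 + lam * L)\<close> is at most 1, the integrand of the
    moment is at most \<open>L / lam\<close>. Hence \<open>S_moment\<close> is a true finite
    expectation and not the default value 0 of a divergent integral.\<close>
  have s_le: "norm (?s z) \<le> norm (loss \<pi> z / lam)" if z: "z \<in> space law" for z
  proof -
    have "(loss \<pi> z)\<^sup>2 * lam \<le> loss \<pi> z * (1 + lam * loss \<pi> z)"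
      using pos[OF z] by (simp add: power2_eq_square algebra_simps)
    then show ?thesis
      using pos[OF z] \<open>lam > 0\<close> by (simp add: divide_simps add_pos_nonneg abs_mult)
  qed
  have s_int: "integrable law ?s"
    by (rule Bochner_Integration.integrable_bound[where f="\<lambda>z. loss \<pi> z / lam"])
       (use integrable_loss[OF \<pi>] s_le in auto)
  have int: "integrable law (\<lambda>z. 1 - lam * loss \<pi> z + lam\<^sup>2 * ?s z)"
    by (intro Bochner_Integration.integrable_add Bochner_Integration.integrable_diff
        integrable_mult_right integrable_loss \<pi> s_int law.integrable_const)
  \<comment> \<open>This is the exact identity 1 / (1 + u) = 1 - u + u^2 / (1 + u) at
    \<open>u = lam * loss \<pi> z\<close>.\<close>
  have inv: "exp (- ln (1 + lam * loss \<pi> z)) = 1 - lam * loss \<pi> z + lam\<^sup>2 * ?s z"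
    if z: "z \<in> space law" for z
  proof -
    have "1 + lam * loss \<pi> z > 0" using pos[OF z] by simp
    then show ?thesis
      by (simp add: exp_minus field_simps power2_eq_square)
  qed
  have "(\<integral>\<^sup>+z. ennreal (exp (- ln (1 + lam * loss \<pi> z))) \<partial>law)
      = (\<integral>\<^sup>+z. ennreal (1 - lam * loss \<pi> z + lam\<^sup>2 * ?s z) \<partial>law)"
    by (intro nn_integral_cong) (simp only: inv)
  also have "\<dots> = ennreal (\<integral>z. 1 - lam * loss \<pi> z + lam\<^sup>2 * ?s z \<partial>law)"
  proof (intro nn_integral_eq_integral[OF int] AE_I2)
    fix z assume "z \<in> space law"
    from inv[OF this, symmetric] show "0 \<le> 1 - lam * loss \<pi> z + lam\<^sup>2 * ?s z" by (simp only: exp_ge_zero)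
  qed
  also have "(\<integral>z. 1 - lam * loss \<pi> z + lam\<^sup>2 * ?s z \<partial>law)
      = 1 + (lam * risk_of \<pi> + lam\<^sup>2 * S_moment X K \<nu> p \<pi>0 lam \<pi>)"
  proof -
    have "(\<integral>z. 1 - lam * loss \<pi> z + lam\<^sup>2 * ?s z \<partial>law)
        = (\<integral>z. 1 - lam * loss \<pi> z \<partial>law) + (\<integral>z. lam\<^sup>2 * ?s z \<partial>law)"
      by (intro Bochner_Integration.integral_add Bochner_Integration.integrable_diff
          integrable_mult_right integrable_loss \<pi> s_int law.integrable_const)
    also have "(\<integral>z. 1 - lam * loss \<pi> z \<partial>law) = 1 - lam * (\<integral>z. loss \<pi> z \<partial>law)"
      using integrable_loss[OF \<pi>] by (simp add: law.prob_space)
    also have "(\<integral>z. lam\<^sup>2 * ?s z \<partial>law) = lam\<^sup>2 * S_moment X K \<nu> p \<pi>0 lam \<pi>"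
      unfolding S_moment_eq by (rule integral_mult_right_zero)
    finally show ?thesis
      by (simp add: integral_loss_eq[OF \<pi> cover])
  qed
  also have "ennreal \<dots> \<le> ennreal (exp (lam * risk_of \<pi> + lam\<^sup>2 * S_moment X K \<nu> p \<pi>0 lam \<pi>))"
    by (intro ennreal_leI exp_ge_add_one_self)
  finally show ?thesis .
qed

section \<open>One-sided deviation bounds for the estimator\<close>

abbreviation "data n \<equiv> data_law X K \<nu> p \<pi>0 n"

lemma prob_space_data: "prob_space (data n)"
  unfolding data_law_def by (intro prob_space_PiM law.prob_space_axioms)

lemma ln_loss_measurable:
  assumes \<pi>: "\<pi> \<in> policies X K"
  shows "(\<lambda>z. ln (1 + lam * loss \<pi> z)) \<in> borel_measurable law"
proof -
  have [measurable]: "loss \<pi> \<in> borel_measurable law"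
    using integrable_loss[OF \<pi>] by auto
  show ?thesis by measurable
qed

text \<open>Multiplying the inequality by \<open>lam * real n\<close> turns it into the event of
  \<open>iid_exponential_Markov\<close> with \<open>b = - lam * risk_of \<pi>\<close>.\<close>

lemma risk_upper_deviation:
  assumes \<pi>: "\<pi> \<in> policies X K" and "lam > 0" "n \<ge> 1" "\<epsilon> > 0"
  defines "B \<equiv> {D \<in> space (data n). risk_of \<pi> > LS_estimator lam \<pi>0 n D \<pi> + ln (1 / \<epsilon>) / (lam * real n)}"
  shows "B \<in> sets (data n)" "measure (data n) B \<le> \<epsilon>"
proof -
  have pos: "lam * real n > 0" using assms by simp
  have iff: "risk_of \<pi> > LS_estimator lam \<pi>0 n D \<pi> + ln (1 / \<epsilon>) / (lam * real n)
      \<longleftrightarrow> real n * (- lam * risk_of \<pi>) + ln (1 / \<epsilon>) < (\<Sum>i=1..n. ln (1 + lam * loss \<pi> (D i)))" for D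
    unfolding LS_estimator_eq add_divide_distrib[symmetric] pos_divide_less_eq[OF pos]
    by (simp add: mult_ac) linarith
  note Markov = iid_exponential_Markov[OF law.prob_space_axioms ln_loss_measurable[OF \<pi>]
        exp_ln_loss_le[OF \<pi> assms(2)] assms(4), of n, folded data_law_def]
  show "B \<in> sets (data n)" "measure (data n) B \<le> \<epsilon>"
    unfolding B_def iff by (fact Markov)+
qed

text \<open>The same argument for the negated logarithms. The exponent carries
  \<open>lam\<^sup>2\<close> times the moment, and division by \<open>lam\<close> leaves the bias
  term \<open>lam * S_moment\<close>.\<close>

lemma risk_lower_deviation:
  assumes \<pi>: "\<pi> \<in> policies X K" and "lam > 0" "n \<ge> 1" "\<epsilon> > 0"
    and cover: "AE x in \<nu>. \<forall>a\<in>{1..K}. measure (\<pi> x) {a} > 0 \<longrightarrow> measure (\<pi>0 x) {a} > 0"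
  defines "B \<equiv> {D \<in> space (data n). LS_estimator lam \<pi>0 n D \<pi>
      > risk_of \<pi> + lam * S_moment X K \<nu> p \<pi>0 lam \<pi> + ln (1 / \<epsilon>) / (lam * real n)}"
  shows "B \<in> sets (data n)" "measure (data n) B \<le> \<epsilon>"
proof -
  let ?S = "S_moment X K \<nu> p \<pi>0 lam \<pi>"
  have pos: "lam * real n > 0" using assms by simp
  have eq: "risk_of \<pi> + lam * ?S + ln (1 / \<epsilon>) / (lam * real n)
      = (real n * (lam * risk_of \<pi> + lam\<^sup>2 * ?S) + ln (1 / \<epsilon>)) / (lam * real n)"
    using assms(2,3) by (simp add: field_simps power2_eq_square)
  have iff: "LS_estimator lam \<pi>0 n D \<pi> > risk_of \<pi> + lam * ?S + ln (1 / \<epsilon>) / (lam * real n)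
      \<longleftrightarrow> real n * (lam * risk_of \<pi> + lam\<^sup>2 * ?S) + ln (1 / \<epsilon>)
        < (\<Sum>i=1..n. - ln (1 + lam * loss \<pi> (D i)))" for D
    unfolding LS_estimator_eq eq sum_negf divide_less_cancel using pos by linarith
  note Markov = iid_exponential_Markov[OF law.prob_space_axioms
        borel_measurable_uminus[OF ln_loss_measurable[OF \<pi>]]
        exp_neg_ln_loss_le[OF \<pi> assms(2) cover] assms(4), of n, folded data_law_def]
  show "B \<in> sets (data n)" "measure (data n) B \<le> \<epsilon>"
    unfolding B_def iff by (fact Markov)+
qed

end

section \<open>Union bound and comparison with the optimum\<close>

theorem proposition9:
  fixes X :: "(real ^ 'd) set" and K n :: nat
    and \<nu> :: "(real ^ 'd) measure"
    and p :: "real ^ 'd \<Rightarrow> nat \<Rightarrow> real measure"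
    and \<pi>0 \<pi>star :: "real ^ 'd \<Rightarrow> nat measure"
    and Pols :: "(real ^ 'd \<Rightarrow> nat measure) set"
    and \<pi>hat :: "(nat \<Rightarrow> (real ^ 'd) \<times> nat \<times> real) \<Rightarrow> real ^ 'd \<Rightarrow> nat measure"
    and lam \<delta> :: real
  assumes "compact X"
    and "K \<ge> 1"
    and "n \<ge> 1"
    and "\<nu> \<in> space (prob_algebra (restrict_space borel X))"
    and "p \<in> cost_kernels X K"
    and "\<pi>0 \<in> policies X K"
    and "finite Pols"
    and "Pols \<subseteq> policies X K"
    and "lam > 0"
    and "\<delta> \<in> {0<..1}"
    and "is_arg_min (risk \<nu> p) (\<lambda>\<pi>. \<pi> \<in> Pols) \<pi>star"
    and "AE x in \<nu>. \<forall>a\<in>{1..K}. measure (\<pi>star x) {a} > 0 \<longrightarrow> measure (\<pi>0 x) {a} > 0"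
    and "\<forall>D\<in>space (data_law X K \<nu> p \<pi>0 n).
           is_arg_min (LS_estimator lam \<pi>0 n D) (\<lambda>\<pi>. \<pi> \<in> Pols) (\<pi>hat D)"
  shows "\<exists>E\<in>sets (data_law X K \<nu> p \<pi>0 n).
           measure (data_law X K \<nu> p \<pi>0 n) E \<ge> 1 - \<delta> \<and>
           (\<forall>D\<in>E. 0 \<le> risk \<nu> p (\<pi>hat D) - risk \<nu> p \<pi>star \<and>
                  risk \<nu> p (\<pi>hat D) - risk \<nu> p \<pi>star
                    \<le> lam * S_moment X K \<nu> p \<pi>0 lam \<pi>star
                       + 2 * ln (2 * real (card Pols) / \<delta>) / (lam * real n))"
proof -
  interpret logged_bandit X K \<nu> p \<pi>0
    by (rule logged_bandit.intro[OF assms(4,5,6)])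
  interpret data: prob_space "data n" by (rule prob_space_data)
  have star: "\<pi>star \<in> Pols" and star_min: "\<And>\<pi>. \<pi> \<in> Pols \<Longrightarrow> risk_of \<pi>star \<le> risk_of \<pi>"
    using assms(11) by (simp_all add: is_arg_min_linorder)
  define m where "m = real (card Pols)"
  have m: "m \<ge> 1"
    using star \<open>finite Pols\<close> card_gt_0_iff[of Pols] by (auto simp: m_def)
  have pol: "\<pi> \<in> policies X K" if "\<pi> \<in> Pols" for \<pi>
    using that \<open>Pols \<subseteq> policies X K\<close> by blast
  have \<delta>: "0 < \<delta>" "\<delta> \<le> 1" using \<open>\<delta> \<in> {0<..1}\<close> by auto
  \<comment> \<open>The m upper deviations together cost \<open>\<delta> / 2\<close>. The single
    lower one costs \<open>\<epsilon>\<close>, again at most \<open>\<delta> / 2\<close> because m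
    is at least 1.\<close>
  define \<epsilon> where "\<epsilon> = \<delta> / (2 * m)"
  have \<epsilon>: "\<epsilon> > 0" using \<delta> m by (simp add: \<epsilon>_def)
  define U where "U \<pi> = {D \<in> space (data n).
      risk_of \<pi> > LS_estimator lam \<pi>0 n D \<pi> + ln (1 / \<epsilon>) / (lam * real n)}" for \<pi>
  define V where "V = {D \<in> space (data n). LS_estimator lam \<pi>0 n D \<pi>star
      > risk_of \<pi>star + lam * S_moment X K \<nu> p \<pi>0 lam \<pi>star + ln (1 / \<epsilon>) / (lam * real n)}"
  have U: "U \<pi> \<in> sets (data n)" "measure (data n) (U \<pi>) \<le> \<epsilon>" if "\<pi> \<in> Pols" for \<pi>
    unfolding U_def by (rule risk_upper_deviation[OF pol[OF that] \<open>lam > 0\<close> \<open>n \<ge> 1\<close> \<epsilon>])+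
  have V: "V \<in> sets (data n)" "measure (data n) V \<le> \<epsilon>"
    unfolding V_def
    by (rule risk_lower_deviation[OF pol[OF star] \<open>lam > 0\<close> \<open>n \<ge> 1\<close> \<epsilon> assms(12)])+
  \<comment> \<open>The selected policy depends on the data, so the upper bound must hold for all
    candidates at once. The optimum is fixed, so one event \<open>V\<close> is enough for
    it.\<close>
  let ?UU = "\<Union>\<pi>\<in>Pols. U \<pi>"
  have UU: "?UU \<in> sets (data n)"
    by (rule sets.finite_UN[OF \<open>finite Pols\<close> U(1)])
  have "measure (data n) (?UU \<union> V) \<le> measure (data n) ?UU + measure (data n) V"
    by (rule measure_Un_le[OF UU V(1)])
  also have "measure (data n) ?UU \<le> (\<Sum>\<pi>\<in>Pols. measure (data n) (U \<pi>))"
    by (rule measure_UNION_le[OF \<open>finite Pols\<close> U(1)])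
  also have "\<dots> \<le> m * \<epsilon>"
    using sum_bounded_above[of Pols "\<lambda>\<pi>. measure (data n) (U \<pi>)" \<epsilon>] U(2) by (simp add: m_def)
  also have "m * \<epsilon> = \<delta> / 2"
    using m by (simp add: \<epsilon>_def)
  also have "measure (data n) V \<le> \<delta> / 2"
  proof -
    have "\<delta> / (2 * m) \<le> \<delta> / 2"
      using m \<delta> by (simp add: field_simps)
    with V(2) show ?thesis by (simp add: \<epsilon>_def)
  qed
  finally have bad: "measure (data n) (?UU \<union> V) \<le> \<delta>" by simp
  \<comment> \<open>The good event is defined without mentioning \<open>\<pi>hat\<close>, so its
    measurability does not depend on how the minimizer is selected.\<close>
  let ?E = "space (data n) - (?UU \<union> V)"
  show ?thesis
  proof (intro bexI[of _ ?E] conjI ballI)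
    show "?E \<in> sets (data n)"
      by (intro sets.compl_sets sets.Un UU V(1))
    show "measure (data n) ?E \<ge> 1 - \<delta>"
      using bad by (simp only: data.prob_compl[OF sets.Un[OF UU V(1)]])
    fix D assume D: "D \<in> ?E"
    then have hat: "\<pi>hat D \<in> Pols"
      and hat_min: "LS_estimator lam \<pi>0 n D (\<pi>hat D) \<le> LS_estimator lam \<pi>0 n D \<pi>star"
      using bspec[OF assms(13), of D] star by (simp_all add: is_arg_min_linorder)
    show "0 \<le> risk_of (\<pi>hat D) - risk_of \<pi>star"
      using star_min[OF hat] by simp
    \<comment> \<open>The chain goes from risk to estimator at \<open>\<pi>hat D\<close>, then to
      the estimator at \<open>\<pi>star\<close>, then back to risk. Each passage between risk and
      estimator costs \<open>ln (1 / \<epsilon>) / (lam * real n)\<close> with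
      \<open>1 / \<epsilon> = 2 * m / \<delta>\<close>, whence the factor 2.\<close>
    have "risk_of (\<pi>hat D) \<le> LS_estimator lam \<pi>0 n D (\<pi>hat D) + ln (1 / \<epsilon>) / (lam * real n)"
      using D hat by (auto simp: U_def not_less)
    also note hat_min
    also have "LS_estimator lam \<pi>0 n D \<pi>star
        \<le> risk_of \<pi>star + lam * S_moment X K \<nu> p \<pi>0 lam \<pi>star + ln (1 / \<epsilon>) / (lam * real n)"
      using D by (auto simp: V_def not_less)
    finally show "risk_of (\<pi>hat D) - risk_of \<pi>star \<le> lam * S_moment X K \<nu> p \<pi>0 lam \<pi>star
        + 2 * ln (2 * real (card Pols) / \<delta>) / (lam * real n)"
      by (simp add: \<epsilon>_def m_def)
  qed
qed

end
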